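(* Let $G$ be a connected non-complete graph and let $H$ be a connected graph of order at least $2$ without universal vertices. (i) If $\operatorname{diam}(H)=2$, then $\mathrm{gp}_{\rm o}(G\circ H)=\omega(G'_{SRS})\,\mathrm{gp}_{\rm o}(H)$. (ii) If $\operatorname{diam}(H)>2$, then $\mathrm{gp}_{\rm o}(G\circ H)=\omega(G'_{SRS})\,\mathrm{gp}_{\rm o}(K_1+H)$.
   Context: All graphs are finite and simple, and (as a standing assumption of the paper) connected. For $X\subseteq V(G)$, two vertices $u,v$ are $X$-positionable if no shortest $u,v$-path has an internal vertex in $X$. $X$ is an outer general position set if every two vertices of $X$ are $X$-positionable and every $u\in X$, $v\in V(G)\setminus X$ are $X$-positionable; $\mathrm{gp}_{\rm o}$ is the maximum cardinality of such a set. A vertex $u$ is maximally distant from $v$ if every neighbour $w$ of $u$ satisfies $d_G(v,w)\le d_G(u,v)$; $u,v$ are mutually maximally distant (MMD) if each is maximally distant from the other. Vertices $x,y$ are true twins if $N_G[x]=N_G[y]$. The TF-boundary $\partial_{TF}(G)$ is the set of vertices $x$ for which there exists $y$ such that $x,y$ are MMD in $G$ and not true twins. $G'_{SRS}$ is the graph with vertex set $\partial_{TF}(G)$ in which $x,y$ are adjacent iff $x,y$ are MMD in $G$ and $N_G[x]\ne N_G[y]$; $\omega$ is the clique number. A universal vertex is adjacent to all other vertices; $K_1+H$ is the join of $K_1$ with $H$. The lexicographic product $G\circ H$ has vertex set $V(G)\times V(H)$, with $(g,h)$ and $(g',h')$ adjacent iff either $gg'\in E(G)$, or $g=g'$ and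 $hh'\in E(H)$. *)

theory Defs
  imports "Graph_Theory.Graph_Theory"
begin

text \<open>
  Finite simple graphs are rendered by the locale \<^locale>\<open>pair_graph\<close>: an undirected edge
  is a pair of opposite arcs, so \<open>(u, v) \<in> parcs G\<close> reads "u and v are adjacent".
  Paths are lists of distinct consecutive adjacent vertices (\<^const>\<open>vpath\<close>).
\<close>

definition path_between :: "'a pair_pre_digraph \<Rightarrow> 'a \<Rightarrow> 'a list \<Rightarrow> 'a \<Rightarrow> bool" where
  "path_between G u p v \<longleftrightarrow> vpath p (with_proj G) \<and> hd p = u \<and> last p = v"

text \<open>Only meaningful if \<open>u\<close> and \<open>v\<close> are joined by a path.\<close>

definition gdist :: "'a pair_pre_digraph \<Rightarrow> 'a \<Rightarrow> 'a \<Rightarrow> nat" where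
  "gdist G u v = (LEAST n. \<exists>p. path_between G u p v \<and> vwalk_length p = n)"

definition shortest_path :: "'a pair_pre_digraph \<Rightarrow> 'a \<Rightarrow> 'a list \<Rightarrow> 'a \<Rightarrow> bool" where
  "shortest_path G u p v \<longleftrightarrow> path_between G u p v \<and> vwalk_length p = gdist G u v"

definition diam :: "'a pair_pre_digraph \<Rightarrow> nat" where
  "diam G = Max {gdist G u v | u v. u \<in> pverts G \<and> v \<in> pverts G}"

definition internal_verts :: "'a list \<Rightarrow> 'a set" where
  "internal_verts p = set (butlast (tl p))"

definition positionable :: "'a pair_pre_digraph \<Rightarrow> 'a set \<Rightarrow> 'a \<Rightarrow> 'a \<Rightarrow> bool" where
  "positionable G X u v \<longleftrightarrow> (\<forall>p. shortest_path G u p v \<longrightarrow> internal_verts p \<inter> X = {})"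

definition outer_gp_set :: "'a pair_pre_digraph \<Rightarrow> 'a set \<Rightarrow> bool" where
  "outer_gp_set G X \<longleftrightarrow> X \<subseteq> pverts G
     \<and> (\<forall>u\<in>X. \<forall>v\<in>X. u \<noteq> v \<longrightarrow> positionable G X u v)
     \<and> (\<forall>u\<in>X. \<forall>v\<in>pverts G - X. positionable G X u v)"

definition gp_outer :: "'a pair_pre_digraph \<Rightarrow> nat" where
  "gp_outer G = Max {card X | X. outer_gp_set G X}"

definition closed_nbhd :: "'a pair_pre_digraph \<Rightarrow> 'a \<Rightarrow> 'a set" where
  "closed_nbhd G x = insert x {y. (x, y) \<in> parcs G}"

definition true_twins :: "'a pair_pre_digraph \<Rightarrow> 'a \<Rightarrow> 'a \<Rightarrow> bool" where
  "true_twins G x y \<longleftrightarrow> closed_nbhd G x = closed_nbhd G y"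

definition maximally_distant :: "'a pair_pre_digraph \<Rightarrow> 'a \<Rightarrow> 'a \<Rightarrow> bool" where
  "maximally_distant G u v \<longleftrightarrow> (\<forall>w. (u, w) \<in> parcs G \<longrightarrow> gdist G v w \<le> gdist G u v)"

definition MMD :: "'a pair_pre_digraph \<Rightarrow> 'a \<Rightarrow> 'a \<Rightarrow> bool" where
  "MMD G u v \<longleftrightarrow> maximally_distant G u v \<and> maximally_distant G v u"

definition TF_boundary :: "'a pair_pre_digraph \<Rightarrow> 'a set" where
  "TF_boundary G = {x \<in> pverts G. \<exists>y\<in>pverts G. MMD G x y \<and> \<not> true_twins G x y}"

definition SRS' :: "'a pair_pre_digraph \<Rightarrow> 'a pair_pre_digraph" where
  "SRS' G = \<lparr> pverts = TF_boundary G,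
     parcs = {(x, y). x \<in> TF_boundary G \<and> y \<in> TF_boundary G
                \<and> MMD G x y \<and> closed_nbhd G x \<noteq> closed_nbhd G y} \<rparr>"

definition clique_in :: "'a pair_pre_digraph \<Rightarrow> 'a set \<Rightarrow> bool" where
  "clique_in G C \<longleftrightarrow> C \<subseteq> pverts G \<and> (\<forall>x\<in>C. \<forall>y\<in>C. x \<noteq> y \<longrightarrow> (x, y) \<in> parcs G)"

definition clique_number :: "'a pair_pre_digraph \<Rightarrow> nat" where
  "clique_number G = Max {card C | C. clique_in G C}"

definition universal_vertex :: "'a pair_pre_digraph \<Rightarrow> 'a \<Rightarrow> bool" where
  "universal_vertex G u \<longleftrightarrow> u \<in> pverts G \<and> (\<forall>v\<in>pverts G. v \<noteq> u \<longrightarrow> (u, v) \<in> parcs G)"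

definition complete_graph :: "'a pair_pre_digraph \<Rightarrow> bool" where
  "complete_graph G \<longleftrightarrow> complete_digraph (card (pverts G)) (with_proj G)"

definition K1 :: "unit pair_pre_digraph" where
  "K1 = \<lparr> pverts = {()}, parcs = {} \<rparr>"

definition graph_join ::
    "'a pair_pre_digraph \<Rightarrow> 'b pair_pre_digraph \<Rightarrow> ('a + 'b) pair_pre_digraph" where
  "graph_join G H = \<lparr> pverts = pverts G <+> pverts H,
     parcs = {(Inl a, Inl a') | a a'. (a, a') \<in> parcs G}
       \<union> {(Inr b, Inr b') | b b'. (b, b') \<in> parcs H}
       \<union> {(Inl a, Inr b) | a b. a \<in> pverts G \<and> b \<in> pverts H}
       \<union> {(Inr b, Inl a) | a b. a \<in> pverts G \<and> b \<in> pverts H} \<rparr>"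

definition lex_product ::
    "'a pair_pre_digraph \<Rightarrow> 'b pair_pre_digraph \<Rightarrow> ('a \<times> 'b) pair_pre_digraph" where
  "lex_product G H = \<lparr> pverts = pverts G \<times> pverts H,
     parcs = {((g, h), (g', h')) | g h g' h'.
       g \<in> pverts G \<and> g' \<in> pverts G \<and> h \<in> pverts H \<and> h' \<in> pverts H
       \<and> ((g, g') \<in> parcs G \<or> g = g' \<and> (h, h') \<in> parcs H)} \<rparr>"

lemma pair_graphI:
  assumes "finite (pverts G)" "parcs G \<subseteq> pverts G \<times> pverts G"
    and "\<And>x y. (x, y) \<in> parcs G \<Longrightarrow> (y, x) \<in> parcs G"
    and "\<And>x. (x, x) \<notin> parcs G"
  shows "pair_graph G"
proof -
  have "finite (parcs G)"
    using assms(1,2) finite_subset by blast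
  then show ?thesis
    using assms by unfold_locales (auto simp: symmetric_def intro!: symI)
qed

lemma pair_graphD:
  assumes "pair_graph G"
  shows "finite (pverts G)" "parcs G \<subseteq> pverts G \<times> pverts G"
    and "(x, y) \<in> parcs G \<Longrightarrow> (y, x) \<in> parcs G"
    and "(x, x) \<notin> parcs G"
proof -
  interpret pair_graph G by fact
  show "finite (pverts G)" by (rule pair_finite_verts)
  show "parcs G \<subseteq> pverts G \<times> pverts G" by (auto intro: wellformed')
  show "(x, y) \<in> parcs G \<Longrightarrow> (y, x) \<in> parcs G"
    using pair_sym_arcs by (auto simp: symmetric_def dest: symD)
  show "(x, x) \<notin> parcs G" using pair_no_loops[of "(x, x)"] by auto
qed

lemma pair_graph_K1: "pair_graph K1"
  by (rule pair_graphI) (auto simp: K1_def)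

lemma pair_graph_lex_product:
  assumes "pair_graph G" "pair_graph H"
  shows "pair_graph (lex_product G H)"
  using pair_graphD[OF assms(1)] pair_graphD[OF assms(2)]
  by (intro pair_graphI) (auto simp: lex_product_def)

lemma pair_graph_join:
  assumes "pair_graph G" "pair_graph H"
  shows "pair_graph (graph_join G H)"
  using pair_graphD[OF assms(1)] pair_graphD[OF assms(2)]
  by (intro pair_graphI) (auto simp: graph_join_def)

lemma pair_graph_SRS':
  assumes "pair_graph G"
  shows "pair_graph (SRS' G)"
  using pair_graphD[OF assms]
  by (intro pair_graphI) (auto simp: SRS'_def MMD_def TF_boundary_def)

end

theory Submission
  imports Defs
begin

text \<open>
  A set is an outer general position set iff its vertices are pairwise MMD, so \<open>gp_outer\<close>
  is the clique number of the MMD relation. In \<open>G \<circ> H\<close> two vertices of one fibre are MMD iff their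
  \<open>H\<close>-coordinates are nonadjacent or true twins, and two vertices of different fibres are MMD iff
  their \<open>G\<close>-coordinates are MMD and nonadjacent: for adjacent \<open>G\<close>-coordinates, being MMD would
  make an \<open>H\<close>-coordinate universal. Maximum cliques of such a relation are products of maximum
  cliques of the factors. Nonadjacent MMD pairs are the edges of \<open>G'\<^sub>S\<^sub>R\<^sub>S\<close>, and
  "nonadjacent or true twins" is the MMD relation of every graph of diameter at most 2, in
  particular of \<open>K\<^sub>1 + H\<close>.
\<close>

section \<open>Distances\<close>

lemma path_betweenD:
  assumes "path_between G u p v"
  shows "p \<noteq> []" "hd p = u" "last p = v" "distinct p" "set p \<subseteq> pverts G"
    "set (vwalk_arcs p) \<subseteq> parcs G" "u \<in> pverts G" "v \<in> pverts G"
  using assms unfolding path_between_def vpath_def vwalk_def by auto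

lemma path_betweenI:
  assumes "p \<noteq> []" "hd p = u" "last p = v" "distinct p" "set p \<subseteq> pverts G"
    "set (vwalk_arcs p) \<subseteq> parcs G"
  shows "path_between G u p v"
  using assms unfolding path_between_def vpath_def vwalk_def by auto

lemma path_between_self: "u \<in> pverts G \<Longrightarrow> path_between G u [u] u"
  by (rule path_betweenI) auto

lemma path_between_snoc:
  assumes "path_between G u p x" "(x, w) \<in> parcs G" "w \<in> pverts G" "w \<notin> set p"
  shows "path_between G u (p @ [w]) w"
  using path_betweenD[OF assms(1)] assms(2-4)
  by (intro path_betweenI) (auto simp: set_vwalk_arcs_snoc)

lemma path_between_prefix:
  assumes "path_between G u (ys @ w # zs) v"
  shows "path_between G u (ys @ [w]) w"
proof (rule path_betweenI)
  have "set (vwalk_arcs (ys @ [w])) \<subseteq> set (vwalk_arcs ((ys @ [w]) @ zs))"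
    by (rule set_vwalk_arcs_append1)
  then show "set (vwalk_arcs (ys @ [w])) \<subseteq> parcs G"
    using path_betweenD(6)[OF assms] by auto
qed (use path_betweenD[OF assms] in \<open>auto simp: hd_append\<close>)

lemma gdist_le: "path_between G u p v \<Longrightarrow> gdist G u v \<le> length p - 1"
  unfolding gdist_def by (rule Least_le) auto

lemma shortest_path_exists:
  assumes "path_between G u p v"
  shows "\<exists>q. path_between G u q v \<and> length q - 1 = gdist G u v"
proof -
  have "\<exists>q. path_between G u q v \<and> vwalk_length q = gdist G u v"
    unfolding gdist_def
    by (rule LeastI[of "\<lambda>n. \<exists>p. path_between G u p v \<and> vwalk_length p = n" "vwalk_length p"])
      (use assms in blast)
  then show ?thesis by simp
qed

text \<open>Telescoping along the arcs; distinctness plays no part. It is used both for a candidate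
  level function and for the distances from a fixed vertex along the tail of a shortest
  path.\<close>

lemma vwalk_level_le:
  assumes "\<And>v w. (v, w) \<in> A \<Longrightarrow> f w \<le> Suc (f v)"
    and "q \<noteq> []" "set (vwalk_arcs q) \<subseteq> A"
  shows "f (last q) \<le> f (hd q) + (length q - 1)"
  using assms(2,3)
proof (induction q rule: vwalk_arcs.induct)
  case (3 x y xs)
  then show ?case using assms(1)[of x y] by fastforce
qed auto

context pair_graph
begin

text \<open>
  A function that vanishes at the root, grows by at most 1 along each arc, and drops by 1 along
  some arc into every other vertex is the distance from the root. All distances in joins and
  lexicographic products are computed this way.
\<close>

context
  fixes f :: "'a \<Rightarrow> nat" and u
  assumes u: "u \<in> pverts G" and f0: "f u = 0"
    and step: "\<And>v w. (v, w) \<in> parcs G \<Longrightarrow> f w \<le> Suc (f v)"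
    and pred: "\<And>w. w \<in> pverts G \<Longrightarrow> w \<noteq> u \<Longrightarrow> \<exists>x. (x, w) \<in> parcs G \<and> f w = Suc (f x)"
begin

text \<open>The bound of \<open>f\<close> along the path strengthens the induction: since
  \<open>f w\<close> exceeds \<open>f x\<close>, the vertex \<open>w\<close> cannot already lie on
  the path to \<open>x\<close>, so appending it keeps the vertices distinct.\<close>

lemma level_path:
  assumes "w \<in> pverts G"
  shows "\<exists>p. path_between G u p w \<and> length p - 1 = f w \<and> (\<forall>x\<in>set p. f x \<le> f w)"
  using assms
proof (induction "f w" arbitrary: w rule: less_induct)
  case less
  show ?case
  proof (cases "w = u")
    case True
    then show ?thesis using path_between_self[OF u] f0 by (intro exI[of _ "[u]"]) auto
  next
    case False
    then obtain x where x: "(x, w) \<in> parcs G" "f w = Suc (f x)" using pred less.prems by blast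
    with less.hyps[of x] obtain p where p: "path_between G u p x" "length p - 1 = f x"
      "\<forall>y\<in>set p. f y \<le> f x"
      by (auto intro: wellformed')
    have "w \<notin> set p" using p(3) x(2) by auto
    then have "path_between G u (p @ [w]) w"
      using path_between_snoc[OF p(1) x(1) less.prems] by simp
    then show ?thesis using p x(2) path_betweenD(1)[OF p(1)]
      by (intro exI[of _ "p @ [w]"]) (cases p; auto)
  qed
qed

lemma level_reachable: "w \<in> pverts G \<Longrightarrow> \<exists>p. path_between G u p w"
  using level_path by blast

lemma gdist_eqI:
  assumes "w \<in> pverts G"
  shows "gdist G u w = f w"
proof (rule antisym)
  obtain p where p: "path_between G u p w" "length p - 1 = f w" using level_path[OF assms] by blast
  then show "gdist G u w \<le> f w" using gdist_le by metis
  obtain q where q: "path_between G u q w" "length q - 1 = gdist G u w"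
    using shortest_path_exists[OF p(1)] by blast
  show "f w \<le> gdist G u w"
    using vwalk_level_le[of "parcs G" f, OF step path_betweenD(1,6)[OF q(1)]]
      path_betweenD(2,3)[OF q(1)] q(2) f0 by simp
qed

end

end

text \<open>Connectedness is phrased with \<open>path_between\<close>, so that cones and
  lexicographic products can be shown connected directly by a level function.\<close>

locale connected_pair_graph = pair_graph +
  assumes path_exists: "u \<in> pverts G \<Longrightarrow> v \<in> pverts G \<Longrightarrow> \<exists>p. path_between G u p v"

lemma connected_pair_graphI:
  assumes "pair_graph G" "connected (with_proj G)"
  shows "connected_pair_graph G"
proof -
  interpret pair_graph G by fact
  have sc: "strongly_connected (with_proj G)"
    by (rule symmetric_connected_imp_strongly_connected[OF pair_sym_arcs assms(2)])
  show ?thesis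
  proof
    fix u v assume "u \<in> pverts G" "v \<in> pverts G"
    then have "u \<rightarrow>\<^sup>*\<^bsub>with_proj G\<^esub> v" using sc by (auto simp: strongly_connected_def)
    then show "\<exists>p. path_between G u p v"
      unfolding path_between_def by (auto simp: reachable_vpath_conv)
  qed
qed

context connected_pair_graph
begin

lemma shortest_path:
  assumes "u \<in> pverts G" "v \<in> pverts G"
  obtains p where "path_between G u p v" "length p - 1 = gdist G u v"
  using shortest_path_exists path_exists[OF assms] by metis

lemma gdist_self: "u \<in> pverts G \<Longrightarrow> gdist G u u = 0"
  using gdist_le[OF path_between_self] by fastforce

text \<open>Paths have distinct vertices, hence the case split: either a shortest path to
  \<open>v\<close> already meets \<open>w\<close> and a prefix of it is short enough, or
  \<open>w\<close> can be appended.\<close>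

lemma gdist_step:
  assumes "u \<in> pverts G" "(v, w) \<in> parcs G"
  shows "gdist G u w \<le> Suc (gdist G u v)"
proof -
  have V: "v \<in> pverts G" "w \<in> pverts G" using assms(2) wellformed' by auto
  obtain p where p: "path_between G u p v" "length p - 1 = gdist G u v"
    using shortest_path[OF assms(1) V(1)] .
  show ?thesis
  proof (cases "w \<in> set p")
    case True
    then obtain ys zs where "p = ys @ w # zs" by (auto dest: split_list)
    then show ?thesis using gdist_le[OF path_between_prefix] p by fastforce
  next
    case False
    then show ?thesis using gdist_le[OF path_between_snoc[OF p(1) assms(2) V(2)]] p(2) by auto
  qed
qed

text \<open>The witness is the last but one vertex of a shortest path, which exists because
  \<open>w\<close> differs from \<open>u\<close>. With \<open>gdist_step\<close> this makes
  \<open>gdist G u\<close> itself a level function.\<close>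

lemma gdist_pred:
  assumes "u \<in> pverts G" "w \<in> pverts G" "w \<noteq> u"
  shows "\<exists>x. (x, w) \<in> parcs G \<and> gdist G u w = Suc (gdist G u x)"
proof -
  obtain p where p: "path_between G u p w" "length p - 1 = gdist G u w"
    using shortest_path[OF assms(1,2)] .
  have "p = butlast p @ [w]" using path_betweenD(1,3)[OF p(1)] by (metis append_butlast_last_id)
  moreover have "butlast p \<noteq> []"
    using path_betweenD(1,2)[OF p(1)] assms(3) calculation by (metis append_Nil list.sel(1))
  ultimately obtain ys x where ys: "p = ys @ x # [w]"
    by (metis append.assoc append_Cons append_Nil rev_exhaust)
  have "gdist G u x \<le> length ys" using gdist_le[OF path_between_prefix] p(1) ys by fastforce
  moreover have xw: "(x, w) \<in> parcs G"
    using path_betweenD(6)[OF p(1)] vwalk_arcs_append[of "ys @ [x]" "[w]"] ys by auto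
  ultimately show ?thesis using gdist_step[OF assms(1) xw] ys p(2) by fastforce
qed

lemma gdist_sym:
  assumes "u \<in> pverts G" "v \<in> pverts G"
  shows "gdist G u v = gdist G v u"
proof -
  have "gdist G b a \<le> gdist G a b" if ab: "a \<in> pverts G" "b \<in> pverts G" for a b
  proof -
    obtain p where p: "path_between G a p b" "length p - 1 = gdist G a b"
      using shortest_path[OF ab] .
    have "path_between G b (rev p) a"
      using path_betweenD[OF p(1)] arcs_symmetric
      by (intro path_betweenI) (auto simp: set_vwalk_arcs_rev hd_rev last_rev)
    from gdist_le[OF this] p(2) show ?thesis by simp
  qed
  then show ?thesis using assms by (simp add: antisym)
qed

lemma gdist_eq_0_iff: "u \<in> pverts G \<Longrightarrow> v \<in> pverts G \<Longrightarrow> gdist G u v = 0 \<longleftrightarrow> u = v"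
  using gdist_pred[of u v] gdist_self by fastforce

lemma gdist_eq_1_iff:
  assumes "u \<in> pverts G" "v \<in> pverts G"
  shows "gdist G u v = Suc 0 \<longleftrightarrow> (u, v) \<in> parcs G"
proof
  assume "gdist G u v = Suc 0"
  moreover from this obtain x where "(x, v) \<in> parcs G" "gdist G u v = Suc (gdist G u x)"
    using gdist_pred[OF assms] gdist_self assms by fastforce
  ultimately show "(u, v) \<in> parcs G" using gdist_eq_0_iff[OF assms(1), of x] wellformed' by auto
next
  assume "(u, v) \<in> parcs G"
  then show "gdist G u v = Suc 0"
    using gdist_step[OF assms(1), of u v] gdist_self[OF assms(1)] gdist_eq_0_iff[OF assms] no_loops'
    by fastforce
qed

lemma gdist_arc: "(u, v) \<in> parcs G \<Longrightarrow> gdist G u v = Suc 0"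
  using gdist_eq_1_iff wellformed' by blast

lemma gdist_ge_2:
  assumes "u \<in> pverts G" "v \<in> pverts G" "u \<noteq> v" "(u, v) \<notin> parcs G"
  shows "2 \<le> gdist G u v"
  using gdist_eq_0_iff[OF assms(1,2)] gdist_eq_1_iff[OF assms(1,2)] assms(3,4) by linarith

section \<open>Mutually maximally distant vertices\<close>

lemma MMD_sym: "MMD G x y \<longleftrightarrow> MMD G y x"
  unfolding MMD_def by auto

text \<open>At distance 1, maximal distance of \<open>a\<close> from \<open>b\<close> confines the
  neighbours of \<open>a\<close> to the unit ball around \<open>b\<close>, that is, to its closed
  neighbourhood. The two directions give the two inclusions.\<close>

lemma arc_MMD_iff_true_twins:
  assumes "(x, y) \<in> parcs G"
  shows "MMD G x y \<longleftrightarrow> true_twins G x y"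
proof -
  have le1: "gdist G a w \<le> Suc 0 \<longleftrightarrow> w \<in> closed_nbhd G a" if "a \<in> pverts G" "w \<in> pverts G" for a w
    using gdist_eq_0_iff[OF that] gdist_eq_1_iff[OF that] unfolding closed_nbhd_def
    by (auto simp: le_Suc_eq)
  have md: "maximally_distant G a b \<longleftrightarrow> closed_nbhd G a \<subseteq> closed_nbhd G b" if "(a, b) \<in> parcs G" for a b
  proof -
    have "gdist G a b = Suc 0" "b \<in> pverts G" "(b, a) \<in> parcs G"
      using gdist_arc that wellformed' arcs_symmetric by auto
    then show ?thesis
      unfolding maximally_distant_def using le1[of b] wellformed'
      by (auto simp: closed_nbhd_def)
  qed
  show ?thesis unfolding MMD_def true_twins_def
    using md[OF assms] md[OF arcs_symmetric[OF assms]] by auto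
qed

lemma true_twins_imp_arc: "true_twins G x y \<Longrightarrow> x \<noteq> y \<Longrightarrow> (x, y) \<in> parcs G"
  unfolding true_twins_def closed_nbhd_def using arcs_symmetric by blast

text \<open>Translates adjacency in \<open>SRS'\<close> into the form that appears between different
  fibres of a lexicographic product.\<close>

lemma MMD_not_true_twins_iff:
  assumes "x \<noteq> y"
  shows "MMD G x y \<and> \<not> true_twins G x y \<longleftrightarrow> MMD G x y \<and> (x, y) \<notin> parcs G"
  using arc_MMD_iff_true_twins true_twins_imp_arc assms by blast

text \<open>Distinct nonadjacent vertices are already at distance 2, so no neighbour of either can
  be farther away.\<close>

lemma MMD_iff_diam_le_2:
  assumes "\<And>u v. u \<in> pverts G \<Longrightarrow> v \<in> pverts G \<Longrightarrow> gdist G u v \<le> 2"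
    and "x \<in> pverts G" "y \<in> pverts G" "x \<noteq> y"
  shows "MMD G x y \<longleftrightarrow> (x, y) \<notin> parcs G \<or> true_twins G x y"
proof (cases "(x, y) \<in> parcs G")
  case False
  then have "(y, x) \<notin> parcs G" using arcs_symmetric by blast
  with False have "gdist G x y = 2" "gdist G y x = 2"
    using gdist_ge_2 assms by (metis antisym)+
  then have "MMD G x y"
    unfolding MMD_def maximally_distant_def using assms(1-3) wellformed' by auto
  with False show ?thesis by simp
qed (simp add: arc_MMD_iff_true_twins)

text \<open>If a neighbour \<open>z\<close> of \<open>w\<close> were farther from \<open>u\<close>
  than \<open>w\<close>, a shortest path from \<open>u\<close> to \<open>w\<close> extended by
  \<open>z\<close> would be a shortest path with \<open>w\<close> inside. Conversely, an internal
  vertex of a shortest path from \<open>u\<close> has a successor farther from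
  \<open>u\<close>.\<close>

lemma outer_gp_set_iff_MMD:
  "outer_gp_set G X \<longleftrightarrow> X \<subseteq> pverts G \<and> (\<forall>x\<in>X. \<forall>y\<in>X. x \<noteq> y \<longrightarrow> MMD G x y)"
proof (intro iffI conjI ballI impI)
  assume X: "outer_gp_set G X"
  \<comment> \<open>The two positionability clauses merge: the second endpoint may lie inside or
    outside \<open>X\<close>.\<close>
  then have V: "X \<subseteq> pverts G"
    and pos: "\<And>u z. u \<in> X \<Longrightarrow> z \<in> pverts G \<Longrightarrow> u \<noteq> z \<Longrightarrow> positionable G X u z"
    unfolding outer_gp_set_def by blast+
  show "X \<subseteq> pverts G" by fact
  have md: "maximally_distant G w u" if "u \<in> X" "w \<in> X" "u \<noteq> w" for u w
    unfolding maximally_distant_def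
  proof (intro allI impI, rule ccontr)
    fix z assume wz: "(w, z) \<in> parcs G" and lt: "\<not> gdist G u z \<le> gdist G w u"
    have uw: "u \<in> pverts G" "w \<in> pverts G" "z \<in> pverts G" using V that wz wellformed' by auto
    have lt: "gdist G u z = Suc (gdist G u w)"
      using lt gdist_sym[OF uw(1,2)] gdist_step[OF uw(1) wz] by simp
    obtain p where p: "path_between G u p w" "length p - 1 = gdist G u w"
      using shortest_path[OF uw(1,2)] .
    have "z \<notin> set p"
    proof
      assume "z \<in> set p"
      then obtain ys zs where "p = ys @ z # zs" by (auto dest: split_list)
      then have "gdist G u z \<le> gdist G u w" using gdist_le[OF path_between_prefix] p by fastforce
      then show False using lt by simp
    qed
    then have "path_between G u (p @ [z]) z" using path_between_snoc[OF p(1) wz uw(3)] by simp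
    moreover have p_ne: "p \<noteq> []" using path_betweenD(1)[OF p(1)] .
    ultimately have sp: "shortest_path G u (p @ [z]) z"
      unfolding shortest_path_def using lt p(2) by (cases p) auto
    have "u \<noteq> z" using lt gdist_self[OF uw(1)] by auto
    then have "internal_verts (p @ [z]) \<inter> X = {}"
      using pos[OF that(1) uw(3)] sp unfolding positionable_def by blast
    moreover have "w \<in> internal_verts (p @ [z])"
      using path_betweenD(2,3)[OF p(1)] p_ne that(3) unfolding internal_verts_def
      by (cases p) (auto split: if_splits)
    ultimately show False using that(2) by blast
  qed
  fix x y assume "x \<in> X" "y \<in> X" "x \<noteq> y"
  then show "MMD G x y" unfolding MMD_def using md by auto
next
  assume X: "X \<subseteq> pverts G \<and> (\<forall>x\<in>X. \<forall>y\<in>X. x \<noteq> y \<longrightarrow> MMD G x y)"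
  have "positionable G X u v" if u: "u \<in> X" for u v
    unfolding positionable_def
  proof (intro allI impI, rule ccontr)
    fix p assume sp: "shortest_path G u p v" and "internal_verts p \<inter> X \<noteq> {}"
    then obtain w where w: "w \<in> set (butlast (tl p))" "w \<in> X" unfolding internal_verts_def by auto
    have p: "path_between G u p v" "length p - 1 = gdist G u v"
      using sp unfolding shortest_path_def by auto
    have D: "p \<noteq> []" "hd p = u" "last p = v" "distinct p" "set (vwalk_arcs p) \<subseteq> parcs G" "u \<in> pverts G"
      using path_betweenD[OF p(1)] by auto
    from w(1) have tl_ne: "tl p \<noteq> []" by auto
    from w(1) obtain as bs where ab: "butlast (tl p) = as @ w # bs" by (auto dest: split_list)
    have "p = u # butlast (tl p) @ [v]"
      using D(1-3) tl_ne by (metis append_butlast_last_id last_tl list.collapse)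
    then have "p = u # as @ w # (bs @ [v])" using ab by simp
    moreover obtain z zs where zs: "bs @ [v] = z # zs" by (cases bs) auto
    ultimately have pe: "p = (u # as) @ w # z # zs" by simp
    have "path_between G u ((u # as) @ [w]) w" using path_between_prefix p(1) pe by metis
    from gdist_le[OF this] have dw: "gdist G u w \<le> Suc (length as)" by simp
    have arcs: "set (vwalk_arcs (w # z # zs)) \<subseteq> parcs G"
      using D(5) set_vwalk_arcs_append2[of "w # z # zs" "u # as"] pe by auto
    \<comment> \<open>The part of \<open>p\<close> after \<open>z\<close> has
      \<open>length zs\<close> arcs. As \<open>p\<close> is shortest, the resulting bound on the
      distance to \<open>v\<close> makes \<open>z\<close> strictly farther from \<open>u\<close>
      than \<open>w\<close>.\<close>
    have "gdist G u (last (z # zs)) \<le> gdist G u (hd (z # zs)) + (length (z # zs) - 1)"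
      by (rule vwalk_level_le[of "parcs G"]) (use gdist_step[OF D(6)] arcs in auto)
    moreover have "last (z # zs) = v" using D(3) pe by simp
    ultimately have "gdist G u v \<le> gdist G u z + length zs" by simp
    then have lt: "gdist G u w < gdist G u z" using dw p(2) pe by simp
    have "u \<noteq> w" using D(4) pe by auto
    then have "maximally_distant G w u" using X u w(2) unfolding MMD_def by blast
    then have "gdist G u z \<le> gdist G w u" using arcs unfolding maximally_distant_def by auto
    then show False using lt gdist_sym[of u w] X u w(2) by auto
  qed
  then show "outer_gp_set G X" unfolding outer_gp_set_def using X by blast
qed

end

section \<open>Maximum cliques of a relation\<close>

text \<open>A common form for \<open>gp_outer\<close> and \<open>clique_number\<close>: one counts
  cliques of \<open>MMD G\<close>, the other cliques of an adjacency relation.\<close>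

definition clique_on :: "'a set \<Rightarrow> ('a \<Rightarrow> 'a \<Rightarrow> bool) \<Rightarrow> 'a set \<Rightarrow> bool" where
  "clique_on A R X \<longleftrightarrow> X \<subseteq> A \<and> (\<forall>x\<in>X. \<forall>y\<in>X. x \<noteq> y \<longrightarrow> R x y)"

definition max_clique :: "'a set \<Rightarrow> ('a \<Rightarrow> 'a \<Rightarrow> bool) \<Rightarrow> nat" where
  "max_clique A R = Max {card X | X. clique_on A R X}"

lemma clique_onD: "clique_on A R X \<Longrightarrow> x \<in> X \<Longrightarrow> y \<in> X \<Longrightarrow> x \<noteq> y \<Longrightarrow> R x y"
  unfolding clique_on_def by blast

lemma clique_on_mono:
  "clique_on A R X \<Longrightarrow> X \<subseteq> B \<Longrightarrow>
    (\<And>x y. x \<in> X \<Longrightarrow> y \<in> X \<Longrightarrow> x \<noteq> y \<Longrightarrow> R x y \<Longrightarrow> S x y) \<Longrightarrow> clique_on B S X"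
  unfolding clique_on_def by blast

lemma finite_clique_cards:
  assumes "finite A" shows "finite {card X | X. clique_on A R X}"
proof -
  have "{card X | X. clique_on A R X} \<subseteq> card ` Pow A" unfolding clique_on_def by auto
  then show ?thesis using assms finite_subset by blast
qed

lemma card_le_max_clique: "finite A \<Longrightarrow> clique_on A R X \<Longrightarrow> card X \<le> max_clique A R"
  unfolding max_clique_def by (rule Max_ge[OF finite_clique_cards]) auto

lemma max_clique_attained:
  assumes "finite A" obtains X where "clique_on A R X" "card X = max_clique A R"
proof -
  have "clique_on A R {}" unfolding clique_on_def by simp
  then have "{card X | X. clique_on A R X} \<noteq> {}" by blast
  from Max_in[OF finite_clique_cards[OF assms] this] show thesis
    using that unfolding max_clique_def by auto
qed

lemma max_clique_ge_1: "finite A \<Longrightarrow> a \<in> A \<Longrightarrow> 1 \<le> max_clique A R"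
  using card_le_max_clique[of A R "{a}"] unfolding clique_on_def by auto

lemma max_clique_cong:
  assumes "\<And>x y. x \<in> A \<Longrightarrow> y \<in> A \<Longrightarrow> x \<noteq> y \<Longrightarrow> R x y \<longleftrightarrow> S x y"
  shows "max_clique A R = max_clique A S"
proof -
  have "clique_on A R = clique_on A S"
    unfolding clique_on_def using assms by (intro ext) blast
  then show ?thesis unfolding max_clique_def by simp
qed

text \<open>A clique of \<open>R\<close> projects to a clique of \<open>T\<close>, and each of its
  fibres is a clique of \<open>S\<close>; counting fibre by fibre gives the upper bound. The product
  of two maximum cliques attains it.\<close>

lemma max_clique_lex:
  assumes A: "finite A" and B: "finite B"
    and fibre: "\<And>a b b'. a \<in> A \<Longrightarrow> b \<in> B \<Longrightarrow> b' \<in> B \<Longrightarrow> b \<noteq> b' \<Longrightarrow> R (a, b) (a, b') \<longleftrightarrow> S b b'"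
    and base: "\<And>a a' b b'. a \<in> A \<Longrightarrow> a' \<in> A \<Longrightarrow> b \<in> B \<Longrightarrow> b' \<in> B \<Longrightarrow> a \<noteq> a' \<Longrightarrow>
      R (a, b) (a', b') \<longleftrightarrow> T a a'"
  shows "max_clique (A \<times> B) R = max_clique A T * max_clique B S"
proof (rule antisym)
  have AB: "finite (A \<times> B)" using A B by simp
  obtain X where X: "clique_on (A \<times> B) R X" "card X = max_clique (A \<times> B) R"
    using max_clique_attained[OF AB] by blast
  then have sub: "X \<subseteq> A \<times> B" unfolding clique_on_def by simp
  have "clique_on A T (fst ` X)"
    unfolding clique_on_def
  proof (intro conjI ballI impI)
    show "fst ` X \<subseteq> A" using sub by auto
    fix a a' assume "a \<in> fst ` X" "a' \<in> fst ` X" "a \<noteq> a'"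
    then obtain b b' where ab: "(a, b) \<in> X" "(a', b') \<in> X" "a \<noteq> a'" by auto
    then have "R (a, b) (a', b')" using clique_onD[OF X(1)] by blast
    moreover have "a \<in> A" "a' \<in> A" "b \<in> B" "b' \<in> B" using ab sub by auto
    ultimately show "T a a'" using base ab(3) by blast
  qed
  then have proj: "card (fst ` X) \<le> max_clique A T" by (rule card_le_max_clique[OF A])
  have fib: "card (X `` {a}) \<le> max_clique B S" for a
  proof (rule card_le_max_clique[OF B])
    show "clique_on B S (X `` {a})"
      unfolding clique_on_def
    proof (intro conjI ballI impI)
      show "X `` {a} \<subseteq> B" using sub by auto
      fix b b' assume "b \<in> X `` {a}" "b' \<in> X `` {a}" "b \<noteq> b'"
      then have ab: "(a, b) \<in> X" "(a, b') \<in> X" "b \<noteq> b'" by auto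
      then have "R (a, b) (a, b')" using clique_onD[OF X(1)] by blast
      moreover have "a \<in> A" "b \<in> B" "b' \<in> B" using ab sub by auto
      ultimately show "S b b'" using fibre ab(3) by blast
    qed
  qed
  have fin: "finite X" using sub AB finite_subset by blast
  \<comment> \<open>\<open>X\<close> is the disjoint union of its fibres over its
    projection.\<close>
  have "X = (SIGMA a:fst ` X. X `` {a})" by force
  then have "card X = (\<Sum>a\<in>fst ` X. card (X `` {a}))"
    using card_SigmaI[of "fst ` X" "\<lambda>a. X `` {a}"] fin by simp
  also have "\<dots> \<le> card (fst ` X) * max_clique B S"
    using sum_bounded_above[of "fst ` X" "\<lambda>a. card (X `` {a})", OF fib] by simp
  also have "\<dots> \<le> max_clique A T * max_clique B S" using proj by simp
  finally show "max_clique (A \<times> B) R \<le> max_clique A T * max_clique B S" using X(2) by simp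
  obtain C where C: "clique_on A T C" "card C = max_clique A T" using max_clique_attained[OF A] .
  obtain D where D: "clique_on B S D" "card D = max_clique B S" using max_clique_attained[OF B] .
  have "clique_on (A \<times> B) R (C \<times> D)"
    unfolding clique_on_def
  proof (intro conjI ballI impI)
    have CD: "C \<subseteq> A" "D \<subseteq> B" using C(1) D(1) unfolding clique_on_def by auto
    then show "C \<times> D \<subseteq> A \<times> B" by auto
    fix x y assume xy: "x \<in> C \<times> D" "y \<in> C \<times> D" "x \<noteq> y"
    obtain a b a' b' where [simp]: "x = (a, b)" "y = (a', b')" by (cases x, cases y)
    have mem: "a \<in> C" "b \<in> D" "a' \<in> C" "b' \<in> D" using xy by auto
    then have AB': "a \<in> A" "b \<in> B" "a' \<in> A" "b' \<in> B" using CD by auto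
    show "R x y"
    proof (cases "a = a'")
      case True
      then have "b \<noteq> b'" using xy(3) by simp
      then have "S b b'" using clique_onD[OF D(1)] mem by blast
      then show ?thesis using fibre[OF AB'(1,2,4)] \<open>b \<noteq> b'\<close> True by simp
    next
      case False
      then have "T a a'" using clique_onD[OF C(1)] mem by blast
      then show ?thesis using base[OF AB'(1,3,2,4) False] by simp
    qed
  qed
  from card_le_max_clique[OF AB this] C(2) D(2)
  show "max_clique A T * max_clique B S \<le> max_clique (A \<times> B) R"
    by (simp add: card_cartesian_product)
qed

section \<open>Graph invariants as maximum cliques\<close>

lemma (in connected_pair_graph) gp_outer_eq: "gp_outer G = max_clique (pverts G) (MMD G)"
  unfolding gp_outer_def max_clique_def outer_gp_set_iff_MMD clique_on_def ..

text \<open>The pair realises the largest distance, so it is MMD. A missing arc forces this distance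
  to be at least 2, so the two vertices are nonadjacent and cannot be true twins.\<close>

lemma (in connected_pair_graph) diametral_MMD:
  assumes "\<not> complete_graph G"
  obtains x y where "x \<in> pverts G" "y \<in> pverts G" "MMD G x y" "\<not> true_twins G x y"
proof -
  have fin: "finite (pverts G)" by (rule pair_finite_verts)
  have "parcs G \<noteq> {(u,v). (u,v) \<in> (pverts G \<times> pverts G) \<and> u \<noteq> v}"
    using assms fin unfolding complete_graph_def complete_digraph_pair_def by blast
  then obtain a b where ab: "a \<in> pverts G" "b \<in> pverts G" "a \<noteq> b" "(a, b) \<notin> parcs G"
    using wellformed' no_loops' by blast
  let ?D = "case_prod (gdist G) ` (pverts G \<times> pverts G)"
  have D: "finite ?D" "?D \<noteq> {}" using fin ab by auto
  obtain x y where xy: "x \<in> pverts G" "y \<in> pverts G" "gdist G x y = Max ?D"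
    using Max_in[OF D] by fastforce
  have max: "gdist G u v \<le> gdist G x y" if "u \<in> pverts G" "v \<in> pverts G" for u v
  proof -
    have "gdist G u v \<in> ?D" using that by force
    then show ?thesis unfolding xy(3) by (rule Max_ge[OF D(1)])
  qed
  have "2 \<le> gdist G x y" using max[OF ab(1,2)] gdist_ge_2[OF ab] by simp
  then have nadj: "x \<noteq> y" "(x, y) \<notin> parcs G" using gdist_self[OF xy(1)] gdist_arc by auto
  have "MMD G x y"
    unfolding MMD_def maximally_distant_def using max gdist_sym[OF xy(1,2)] xy(1,2) wellformed' by auto
  then show thesis using that xy(1,2) nadj true_twins_imp_arc by blast
qed

text \<open>Any two distinct vertices related by \<open>?T\<close> lie in the TF-boundary. Passing
  from the boundary to all vertices therefore adds no clique with two or more elements.\<close>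

lemma (in connected_pair_graph) clique_number_SRS':
  assumes "\<not> complete_graph G"
  shows "clique_number (SRS' G) = max_clique (pverts G) (\<lambda>x y. MMD G x y \<and> (x, y) \<notin> parcs G)"
    (is "_ = max_clique _ ?T")
proof -
  let ?S = "\<lambda>x y. (x, y) \<in> parcs (SRS' G)"
  have fin: "finite (pverts G)" by (rule pair_finite_verts)
  have S: "pverts (SRS' G) \<subseteq> pverts G" unfolding SRS'_def TF_boundary_def by auto
  then have finS: "finite (pverts (SRS' G))" using fin finite_subset by blast
  have ST: "?S x y \<longleftrightarrow> ?T x y" if "x \<in> pverts G" "y \<in> pverts G" "x \<noteq> y" for x y
    using MMD_not_true_twins_iff[OF that(3)] that MMD_sym[of x y]
    unfolding SRS'_def TF_boundary_def true_twins_def by auto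
  have bd: "x \<in> pverts (SRS' G)" if "?S x y" for x y
    using that unfolding SRS'_def by auto
  \<comment> \<open>Non-completeness makes the TF-boundary nonempty.\<close>
  obtain a where a: "a \<in> pverts (SRS' G)"
  proof -
    obtain x y where "x \<in> pverts G" "y \<in> pverts G" "MMD G x y" "\<not> true_twins G x y"
      using diametral_MMD[OF assms] .
    then show thesis using that[of x] unfolding SRS'_def TF_boundary_def by auto
  qed
  have "max_clique (pverts (SRS' G)) ?S = max_clique (pverts G) ?T"
  proof (rule antisym)
    obtain X where X: "clique_on (pverts (SRS' G)) ?S X" "card X = max_clique (pverts (SRS' G)) ?S"
      using max_clique_attained[OF finS] .
    then have XV: "X \<subseteq> pverts G" using S unfolding clique_on_def by blast
    have "clique_on (pverts G) ?T X"
      by (rule clique_on_mono[OF X(1) XV]) (use ST XV in blast)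
    from card_le_max_clique[OF fin this] X(2)
    show "max_clique (pverts (SRS' G)) ?S \<le> max_clique (pverts G) ?T" by simp
    obtain Y where Y: "clique_on (pverts G) ?T Y" "card Y = max_clique (pverts G) ?T"
      using max_clique_attained[OF fin] .
    show "max_clique (pverts G) ?T \<le> max_clique (pverts (SRS' G)) ?S"
      \<comment> \<open>A one-element clique of \<open>?T\<close> may lie outside the TF-boundary; \<open>a\<close> replaces it.\<close>
    proof (cases "\<exists>x\<in>Y. \<exists>y\<in>Y. x \<noteq> y")
      case False
      then have "card Y \<le> 1" by (metis card_le_Suc0_iff_eq card.infinite One_nat_def zero_le)
      then show ?thesis using max_clique_ge_1[OF finS a, of ?S] Y(2) by simp
    next
      case True
      have "Y \<subseteq> pverts G" using Y(1) unfolding clique_on_def by blast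
      then have YS: "?S x y" if "x \<in> Y" "y \<in> Y" "x \<noteq> y" for x y
        using clique_onD[OF Y(1) that] ST[of x y] that by auto
      have "Y \<subseteq> pverts (SRS' G)"
      proof
        fix x assume x: "x \<in> Y"
        then obtain y where "y \<in> Y" "x \<noteq> y" using True by auto
        then show "x \<in> pverts (SRS' G)" using YS[OF x] bd by blast
      qed
      then have "clique_on (pverts (SRS' G)) ?S Y"
        by (rule clique_on_mono[OF Y(1)]) (rule YS)
      from card_le_max_clique[OF finS this] Y(2) show ?thesis by simp
    qed
  qed
  then show ?thesis unfolding clique_number_def max_clique_def clique_on_def clique_in_def .
qed

lemma (in connected_pair_graph) gdist_le_diam:
  assumes "u \<in> pverts G" "v \<in> pverts G"
  shows "gdist G u v \<le> diam G"
proof -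
  have "{gdist G u v | u v. u \<in> pverts G \<and> v \<in> pverts G} = case_prod (gdist G) ` (pverts G \<times> pverts G)"
    by auto
  then have "finite {gdist G u v | u v. u \<in> pverts G \<and> v \<in> pverts G}"
    using pair_finite_verts by simp
  then show ?thesis unfolding diam_def using assms by (intro Max_ge) auto
qed

section \<open>The join with a single vertex\<close>

text \<open>The distance truncated at 2.\<close>

definition dist2 :: "'a pair_pre_digraph \<Rightarrow> 'a \<Rightarrow> 'a \<Rightarrow> nat" where
  "dist2 H x y = (if x = y then 0 else if (x, y) \<in> parcs H then 1 else 2)"

text \<open>The level function for the cone with apex \<open>Inl ()\<close>: distinct nonadjacent
  vertices of \<open>H\<close> are at distance 2 through the apex.\<close>

fun cone_dist :: "'a pair_pre_digraph \<Rightarrow> unit + 'a \<Rightarrow> unit + 'a \<Rightarrow> nat" where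
  "cone_dist H (Inl _) (Inl _) = 0"
| "cone_dist H (Inl _) (Inr _) = 1"
| "cone_dist H (Inr _) (Inl _) = 1"
| "cone_dist H (Inr x) (Inr y) = dist2 H x y"

lemma cone_simps:
  "pverts (graph_join K1 H) = insert (Inl ()) (Inr ` pverts H)"
  "(Inl a, Inl b) \<notin> parcs (graph_join K1 H)"
  "(Inl a, Inr y) \<in> parcs (graph_join K1 H) \<longleftrightarrow> y \<in> pverts H"
  "(Inr x, Inl b) \<in> parcs (graph_join K1 H) \<longleftrightarrow> x \<in> pverts H"
  "(Inr x, Inr y) \<in> parcs (graph_join K1 H) \<longleftrightarrow> (x, y) \<in> parcs H"
  unfolding graph_join_def K1_def by auto

context pair_graph
begin

lemma cone_level:
  assumes "u \<in> pverts (graph_join K1 G)"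
  shows "cone_dist G u u = 0"
    and "(v, w) \<in> parcs (graph_join K1 G) \<Longrightarrow> cone_dist G u w \<le> Suc (cone_dist G u v)"
    and "w \<in> pverts (graph_join K1 G) \<Longrightarrow> w \<noteq> u \<Longrightarrow>
      \<exists>x. (x, w) \<in> parcs (graph_join K1 G) \<and> cone_dist G u w = Suc (cone_dist G u x)"
proof -
  show "cone_dist G u u = 0" by (cases u) (auto simp: dist2_def)
  show "cone_dist G u w \<le> Suc (cone_dist G u v)" if "(v, w) \<in> parcs (graph_join K1 G)"
    using that by (cases u; cases v; cases w) (auto simp: cone_simps dist2_def)
  show "\<exists>x. (x, w) \<in> parcs (graph_join K1 G) \<and> cone_dist G u w = Suc (cone_dist G u x)"
    if w: "w \<in> pverts (graph_join K1 G)" "w \<noteq> u"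
  proof (cases "(u, w) \<in> parcs (graph_join K1 G)")
    case True
    then show ?thesis using assms w
      by (intro exI[of _ u], cases u; cases w) (auto simp: cone_simps dist2_def)
  next
    case False
    \<comment> \<open>Here both vertices lie in the base, and the apex precedes
      \<open>w\<close>.\<close>
    then show ?thesis using assms w
      by (intro exI[of _ "Inl ()"], cases u; cases w) (auto simp: cone_simps dist2_def)
  qed
qed

lemma connected_cone: "connected_pair_graph (graph_join K1 G)"
proof -
  interpret K: pair_graph "graph_join K1 G"
    by (rule pair_graph_join[OF pair_graph_K1 pair_graph])
  show ?thesis
  proof
    fix u v assume uv: "u \<in> pverts (graph_join K1 G)" "v \<in> pverts (graph_join K1 G)"
    show "\<exists>p. path_between (graph_join K1 G) u p v"
      by (rule K.level_reachable[where f = "cone_dist G u"]) (use uv cone_level in blast)+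
  qed
qed

lemma gdist_cone_le_2:
  assumes "u \<in> pverts (graph_join K1 G)" "v \<in> pverts (graph_join K1 G)"
  shows "gdist (graph_join K1 G) u v \<le> 2"
proof -
  interpret K: pair_graph "graph_join K1 G"
    by (rule pair_graph_join[OF pair_graph_K1 pair_graph])
  have "gdist (graph_join K1 G) u v = cone_dist G u v"
    by (rule K.gdist_eqI) (use assms cone_level in blast)+
  then show ?thesis by (cases u; cases v) (auto simp: dist2_def)
qed

text \<open>The apex joins both closed neighbourhoods of a pair in the base, so true twins are the
  same as in \<open>G\<close>. A base vertex MMD with the apex would be its true twin, hence
  universal in \<open>G\<close>; so the apex lies only in a one-element clique.\<close>

lemma gp_outer_cone:
  assumes ne: "pverts G \<noteq> {}" and nu: "\<not> (\<exists>u. universal_vertex G u)"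
  shows "gp_outer (graph_join K1 G)
    = max_clique (pverts G) (\<lambda>x y. (x, y) \<notin> parcs G \<or> true_twins G x y)"
    (is "_ = max_clique _ ?S")
proof -
  let ?K = "graph_join K1 G"
  interpret K: connected_pair_graph ?K by (rule connected_cone)
  have fin: "finite (pverts G)" by (rule pair_finite_verts)
  have MMD_K: "MMD ?K a b \<longleftrightarrow> (a, b) \<notin> parcs ?K \<or> true_twins ?K a b"
    if "a \<in> pverts ?K" "b \<in> pverts ?K" "a \<noteq> b" for a b
    using K.MMD_iff_diam_le_2[OF gdist_cone_le_2 that] by blast
  have nbr: "closed_nbhd ?K (Inr x) = insert (Inl ()) (Inr ` closed_nbhd G x)"
    if "x \<in> pverts G" for x
  proof (rule set_eqI)
    fix z show "z \<in> closed_nbhd ?K (Inr x) \<longleftrightarrow> z \<in> insert (Inl ()) (Inr ` closed_nbhd G x)"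
      using that by (cases z) (auto simp: closed_nbhd_def cone_simps image_iff)
  qed
  have nbl: "closed_nbhd ?K (Inl ()) = insert (Inl ()) (Inr ` pverts G)"
  proof (rule set_eqI)
    fix z show "z \<in> closed_nbhd ?K (Inl ()) \<longleftrightarrow> z \<in> insert (Inl ()) (Inr ` pverts G)"
      by (cases z) (auto simp: closed_nbhd_def cone_simps image_iff)
  qed
  have MMD_rr: "MMD ?K (Inr x) (Inr y) \<longleftrightarrow> ?S x y"
    if "x \<in> pverts G" "y \<in> pverts G" "x \<noteq> y" for x y
  proof -
    have "insert (Inl ()) (Inr ` A) = insert (Inl ()) (Inr ` B) \<longleftrightarrow> A = B" for A B :: "'a set"
      by blast
    then show ?thesis
      using MMD_K[of "Inr x" "Inr y"] that nbr by (auto simp: cone_simps true_twins_def)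
  qed
  have MMD_lr: "\<not> MMD ?K (Inl ()) (Inr y)" if "y \<in> pverts G" for y
  proof
    assume "MMD ?K (Inl ()) (Inr y)"
    then have "true_twins ?K (Inl ()) (Inr y)" using MMD_K[of "Inl ()" "Inr y"] that by (simp add: cone_simps)
    then have "pverts G \<subseteq> closed_nbhd G y" unfolding true_twins_def nbl nbr[OF that] by blast
    then have "universal_vertex G y"
      using that unfolding universal_vertex_def closed_nbhd_def by auto
    then show False using nu by blast
  qed
  have finK: "finite (pverts ?K)" by (rule K.pair_finite_verts)
  have "max_clique (pverts ?K) (MMD ?K) = max_clique (pverts G) ?S"
  proof (rule antisym)
    obtain X where X: "clique_on (pverts ?K) (MMD ?K) X" "card X = max_clique (pverts ?K) (MMD ?K)"
      using max_clique_attained[OF finK] .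
    have sub: "X \<subseteq> insert (Inl ()) (Inr ` pverts G)" using X(1) by (simp add: clique_on_def cone_simps)
    show "max_clique (pverts ?K) (MMD ?K) \<le> max_clique (pverts G) ?S"
    proof (cases "Inl () \<in> X")
      case True
      then have "X = {Inl ()}" using sub MMD_lr clique_onD[OF X(1) True] by blast
      then show ?thesis using X(2) ne max_clique_ge_1[OF fin, of _ ?S] by auto
    next
      case False
      then obtain Y where Y: "X = Inr ` Y" "Y \<subseteq> pverts G" using sub by (metis subset_image_iff subset_insert)
      then have "clique_on (pverts G) ?S Y"
        using clique_onD[OF X(1)] MMD_rr unfolding clique_on_def by blast
      from card_le_max_clique[OF fin this] X(2) Y(1) show ?thesis by (simp add: card_image)
    qed
    obtain Y where Y: "clique_on (pverts G) ?S Y" "card Y = max_clique (pverts G) ?S"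
      using max_clique_attained[OF fin] .
    have "clique_on (pverts ?K) (MMD ?K) (Inr ` Y)"
      using Y(1) MMD_rr unfolding clique_on_def cone_simps by blast
    from card_le_max_clique[OF finK this] Y(2)
    show "max_clique (pverts G) ?S \<le> max_clique (pverts ?K) (MMD ?K)" by (simp add: card_image)
  qed
  then show ?thesis by (simp add: K.gp_outer_eq)
qed

end

section \<open>Lexicographic products\<close>

lemma lex_simps:
  "pverts (lex_product G H) = pverts G \<times> pverts H"
  "((g, h), (g', h')) \<in> parcs (lex_product G H) \<longleftrightarrow>
     g \<in> pverts G \<and> g' \<in> pverts G \<and> h \<in> pverts H \<and> h' \<in> pverts H
       \<and> ((g, g') \<in> parcs G \<or> g = g' \<and> (h, h') \<in> parcs H)"
  unfolding lex_product_def by auto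

text \<open>Between different fibres only the \<open>G\<close>-coordinates count. Inside a fibre,
  distinct nonadjacent vertices are joined by a detour of length 2 through a neighbouring
  fibre.\<close>

definition lex_dist :: "'a pair_pre_digraph \<Rightarrow> 'b pair_pre_digraph \<Rightarrow> 'a \<times> 'b \<Rightarrow> 'a \<times> 'b \<Rightarrow> nat" where
  "lex_dist G H u v = (if fst u = fst v then dist2 H (snd u) (snd v) else gdist G (fst u) (fst v))"

text \<open>\<open>nbr\<close> provides the neighbouring fibre through which any two vertices of one
  fibre are joined in two steps.\<close>

locale lex_factors = G: connected_pair_graph G + H: pair_graph H
  for G :: "'a pair_pre_digraph" and H :: "'b pair_pre_digraph" +
  assumes nbr: "g \<in> pverts G \<Longrightarrow> \<exists>g'. (g, g') \<in> parcs G"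
begin

sublocale L: pair_graph "lex_product G H"
  by (rule pair_graph_lex_product[OF G.pair_graph H.pair_graph])

lemma lex_level:
  assumes "u \<in> pverts (lex_product G H)"
  shows "lex_dist G H u u = 0"
    and "(v, w) \<in> parcs (lex_product G H) \<Longrightarrow> lex_dist G H u w \<le> Suc (lex_dist G H u v)"
    and "w \<in> pverts (lex_product G H) \<Longrightarrow> w \<noteq> u \<Longrightarrow>
      \<exists>x. (x, w) \<in> parcs (lex_product G H) \<and> lex_dist G H u w = Suc (lex_dist G H u x)"
proof -
  obtain g h where u: "u = (g, h)" by (cases u)
  have gh: "g \<in> pverts G" "h \<in> pverts H" using assms u by (auto simp: lex_simps)
  show "lex_dist G H u u = 0" by (simp add: lex_dist_def dist2_def)
  show "lex_dist G H u w \<le> Suc (lex_dist G H u v)" if vw: "(v, w) \<in> parcs (lex_product G H)"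
  proof -
    obtain a b c d where [simp]: "v = (a, b)" "w = (c, d)" by (cases v, cases w)
    have abcd: "a \<in> pverts G" "c \<in> pverts G" "(a, c) \<in> parcs G \<or> a = c \<and> (b, d) \<in> parcs H"
      using vw by (auto simp: lex_simps)
    show ?thesis
    proof (cases "(a, c) \<in> parcs G")
      case True
      then have "a \<noteq> c" using G.no_loops' by blast
      \<comment> \<open>An arc back into the fibre of \<open>u\<close> starts at level 1, and levels
        inside that fibre are at most 2.\<close>
      show ?thesis
        using True \<open>a \<noteq> c\<close> u gh G.gdist_arc[OF True] G.gdist_step[OF gh(1) True] G.gdist_self[OF gh(1)]
          G.gdist_eq_0_iff[OF gh(1) abcd(1)]
        by (auto simp: lex_dist_def dist2_def)
    next
      case False
      then show ?thesis using abcd u by (auto simp: lex_dist_def dist2_def)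
    qed
  qed
  show "\<exists>x. (x, w) \<in> parcs (lex_product G H) \<and> lex_dist G H u w = Suc (lex_dist G H u x)"
    if w: "w \<in> pverts (lex_product G H)" "w \<noteq> u"
  proof -
    obtain c d where [simp]: "w = (c, d)" by (cases w)
    have cd: "c \<in> pverts G" "d \<in> pverts H" using w by (auto simp: lex_simps)
    show ?thesis
    proof (cases "c = g")
      case True
      show ?thesis
      proof (cases "(h, d) \<in> parcs H")
        case hd: True
        then have "h \<noteq> d" using H.no_loops' by blast
        with hd True gh cd u show ?thesis
          by (intro exI[of _ u]) (auto simp: lex_simps lex_dist_def dist2_def)
      next
        case False
        \<comment> \<open>The detour: leave the fibre of \<open>u\<close> to \<open>(a, h)\<close>
          and return to \<open>w\<close>.\<close>
        obtain a where a: "(g, a) \<in> parcs G" using nbr gh(1) by blast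
        then have "g \<noteq> a" "a \<in> pverts G" "(a, g) \<in> parcs G" "gdist G g a = Suc 0"
          using G.no_loops' G.wellformed' G.arcs_symmetric G.gdist_arc by blast+
        with False True gh cd u w(2) show ?thesis
          by (intro exI[of _ "(a, h)"]) (auto simp: lex_simps lex_dist_def dist2_def)
      qed
    next
      case False
      obtain x where x: "(x, c) \<in> parcs G" "gdist G g c = Suc (gdist G g x)"
        using G.gdist_pred[OF gh(1) cd(1) False] by blast
      \<comment> \<open>The predecessor of \<open>w\<close> lies over \<open>x\<close>. If
        \<open>x = g\<close>, its second coordinate must be \<open>h\<close>, so that it is
        \<open>u\<close> itself and has level 0.\<close>
      have "x \<in> pverts G" using x(1) G.wellformed' by blast
      then show ?thesis
        using x False gh cd u G.gdist_self[OF gh(1)]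
        by (intro exI[of _ "(x, if x = g then h else d)"]) (auto simp: lex_simps lex_dist_def dist2_def)
    qed
  qed
qed

lemma gdist_lex:
  assumes "u \<in> pverts (lex_product G H)" "v \<in> pverts (lex_product G H)"
  shows "gdist (lex_product G H) u v = lex_dist G H u v"
  by (rule L.gdist_eqI) (use assms lex_level in blast)+

sublocale L: connected_pair_graph "lex_product G H"
proof
  fix u v assume uv: "u \<in> pverts (lex_product G H)" "v \<in> pverts (lex_product G H)"
  show "\<exists>p. path_between (lex_product G H) u p v"
    by (rule L.level_reachable[where f = "lex_dist G H u"]) (use uv lex_level in blast)+
qed

text \<open>As \<open>g\<close> and \<open>g'\<close> are nonadjacent, no neighbour of
  \<open>(g, h)\<close> lies in the fibre of \<open>g'\<close>. All distances compared are thus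
  distances in \<open>G\<close>, and moves inside the fibre of \<open>g\<close> leave them
  unchanged.\<close>

lemma maximally_distant_lex_base:
  assumes V: "g \<in> pverts G" "g' \<in> pverts G" "h \<in> pverts H" "h' \<in> pverts H"
    and nadj: "g \<noteq> g'" "(g, g') \<notin> parcs G"
  shows "maximally_distant (lex_product G H) (g, h) (g', h') \<longleftrightarrow> maximally_distant G g g'"
proof
  assume md: "maximally_distant (lex_product G H) (g, h) (g', h')"
  show "maximally_distant G g g'"
    unfolding maximally_distant_def
  proof (intro allI impI)
    fix w assume w: "(g, w) \<in> parcs G"
    then have wV: "w \<in> pverts G" "w \<noteq> g'" using G.wellformed' nadj(2) by auto
    have "((g, h), (w, h)) \<in> parcs (lex_product G H)" using w wV V by (simp add: lex_simps)
    then have "gdist (lex_product G H) (g', h') (w, h) \<le> gdist (lex_product G H) (g, h) (g', h')"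
      using md unfolding maximally_distant_def by blast
    then show "gdist G g' w \<le> gdist G g g'"
      using V wV nadj(1) by (simp add: gdist_lex lex_simps lex_dist_def)
  qed
next
  assume md: "maximally_distant G g g'"
  show "maximally_distant (lex_product G H) (g, h) (g', h')"
    unfolding maximally_distant_def
  proof (intro allI impI)
    fix w assume w: "((g, h), w) \<in> parcs (lex_product G H)"
    obtain c d where [simp]: "w = (c, d)" by (cases w)
    have cd: "c \<in> pverts G" "d \<in> pverts H" "c = g \<or> (g, c) \<in> parcs G" using w by (auto simp: lex_simps)
    then have "c \<noteq> g'" using nadj by blast
    moreover have "gdist G g' c \<le> gdist G g g'"
      using cd(3) md G.gdist_sym[OF V(1,2)] unfolding maximally_distant_def by auto
    ultimately show "gdist (lex_product G H) (g', h') w \<le> gdist (lex_product G H) (g, h) (g', h')"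
      using V cd nadj(1) by (simp add: gdist_lex lex_simps lex_dist_def)
  qed
qed

lemma MMD_lex_base:
  assumes V: "g \<in> pverts G" "g' \<in> pverts G" "h \<in> pverts H" "h' \<in> pverts H" and ne: "g \<noteq> g'"
    and nu: "\<not> (\<exists>u. universal_vertex H u)"
  shows "MMD (lex_product G H) (g, h) (g', h') \<longleftrightarrow> MMD G g g' \<and> (g, g') \<notin> parcs G"
proof (cases "(g, g') \<in> parcs G")
  case True
  have arc: "((g, h), (g', h')) \<in> parcs (lex_product G H)" using True V by (simp add: lex_simps)
  \<comment> \<open>For such a non-neighbour \<open>x\<close> of \<open>h'\<close>, the vertex
    \<open>(g', x)\<close> is adjacent to \<open>(g, h)\<close> but not to \<open>(g', h')\<close>,
    which rules out true twins.\<close>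
  obtain x where x: "x \<in> pverts H" "x \<noteq> h'" "(h', x) \<notin> parcs H"
    using nu V(4) unfolding universal_vertex_def by blast
  have "(g', x) \<in> closed_nbhd (lex_product G H) (g, h)" "(g', x) \<notin> closed_nbhd (lex_product G H) (g', h')"
    using True V x G.no_loops' unfolding closed_nbhd_def by (auto simp: lex_simps)
  then have "\<not> true_twins (lex_product G H) (g, h) (g', h')" unfolding true_twins_def by blast
  then show ?thesis using True L.arc_MMD_iff_true_twins[OF arc] by simp
next
  case False
  then have "(g', g) \<notin> parcs G" using G.arcs_symmetric by blast
  then show ?thesis
    using False maximally_distant_lex_base[OF V ne False]
      maximally_distant_lex_base[OF V(2,1,4,3) ne[symmetric]]
    unfolding MMD_def by blast
qed

text \<open>Outside their fibre both vertices have the same neighbours, so in the adjacent case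
  twinship is decided in \<open>H\<close>. In the nonadjacent case their distance is 2, and every
  neighbour stays in the fibre or moves to an adjacent one, hence within distance 2.\<close>

lemma MMD_lex_fibre:
  assumes V: "g \<in> pverts G" "h \<in> pverts H" "h' \<in> pverts H" and ne: "h \<noteq> h'"
  shows "MMD (lex_product G H) (g, h) (g, h') \<longleftrightarrow> (h, h') \<notin> parcs H \<or> true_twins H h h'"
proof (cases "(h, h') \<in> parcs H")
  case True
  have arc: "((g, h), (g, h')) \<in> parcs (lex_product G H)" using True V by (simp add: lex_simps)
  have N: "closed_nbhd (lex_product G H) (g, x) = {c. (g, c) \<in> parcs G} \<times> pverts H \<union> {g} \<times> closed_nbhd H x"
    if "x \<in> pverts H" for x
    using that V(1) G.wellformed' H.wellformed' unfolding closed_nbhd_def by (auto simp: lex_simps)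
  \<comment> \<open>Keeps the two parts of \<open>N\<close> disjoint, so that the parts inside the
    fibre can be compared.\<close>
  have "(g, g) \<notin> parcs G" using G.no_loops' by blast
  then have "true_twins (lex_product G H) (g, h) (g, h') \<longleftrightarrow> true_twins H h h'"
    unfolding true_twins_def N[OF V(2)] N[OF V(3)] by blast
  then show ?thesis using True L.arc_MMD_iff_true_twins[OF arc] by simp
next
  case False
  then have nadj: "(h', h) \<notin> parcs H" using H.arcs_symmetric by blast
  have "maximally_distant (lex_product G H) (g, x) (g, y)"
    if xy: "x \<in> pverts H" "y \<in> pverts H" "x \<noteq> y" "(x, y) \<notin> parcs H" for x y
    unfolding maximally_distant_def
  proof (intro allI impI)
    fix w assume w: "((g, x), w) \<in> parcs (lex_product G H)"
    obtain c d where [simp]: "w = (c, d)" by (cases w)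
    have "c \<in> pverts G" "d \<in> pverts H" "c = g \<or> gdist G g c = Suc 0"
      using w G.gdist_arc by (auto simp: lex_simps)
    then show "gdist (lex_product G H) (g, y) w \<le> gdist (lex_product G H) (g, x) (g, y)"
      using V(1) xy by (auto simp: gdist_lex lex_simps lex_dist_def dist2_def)
  qed
  then have "MMD (lex_product G H) (g, h) (g, h')" unfolding MMD_def using V ne False nadj by blast
  with False show ?thesis by simp
qed

text \<open>\<open>max_clique_lex\<close> applied to MMD in the product. The diameter of
  \<open>H\<close> enters later, when the second factor is recognised as an outer general position
  number.\<close>

theorem gp_outer_lex_product:
  assumes "\<not> complete_graph G" "\<not> (\<exists>u. universal_vertex H u)"
  shows "gp_outer (lex_product G H) = clique_number (SRS' G) *
    max_clique (pverts H) (\<lambda>x y. (x, y) \<notin> parcs H \<or> true_twins H x y)"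
  unfolding L.gp_outer_eq G.clique_number_SRS'[OF assms(1)] lex_simps(1)
  by (rule max_clique_lex)
    (use assms(2) MMD_lex_fibre MMD_lex_base in \<open>simp_all add: G.pair_finite_verts H.pair_finite_verts\<close>)

end

theorem theorem5p8:
  fixes G :: "'a pair_pre_digraph" and H :: "'b pair_pre_digraph"
  assumes "pair_graph G" and "connected (with_proj G)" and "\<not> complete_graph G"
    and "pair_graph H" and "connected (with_proj H)" and "card (pverts H) \<ge> 2"
    and "\<not> (\<exists>u. universal_vertex H u)"
  shows "(diam H = 2 \<longrightarrow>
            gp_outer (lex_product G H) = clique_number (SRS' G) * gp_outer H) \<and>
         (diam H > 2 \<longrightarrow>
            gp_outer (lex_product G H) = clique_number (SRS' G) * gp_outer (graph_join K1 H))"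
proof -
  let ?S = "\<lambda>x y. (x, y) \<notin> parcs H \<or> true_twins H x y"
  interpret G: connected_pair_graph G by (rule connected_pair_graphI) fact+
  interpret H: connected_pair_graph H by (rule connected_pair_graphI) fact+
  \<comment> \<open>Every vertex is its own true twin, so a diametral pair consists of two distinct
    vertices.\<close>
  obtain a b where ab: "a \<in> pverts G" "b \<in> pverts G" "a \<noteq> b"
  proof -
    obtain x y where "x \<in> pverts G" "y \<in> pverts G" "MMD G x y" "\<not> true_twins G x y"
      using G.diametral_MMD[OF assms(3)] .
    then show thesis using that[of x y] unfolding true_twins_def by blast
  qed
  interpret lex_factors G H
  proof
    fix g assume g: "g \<in> pverts G"
    \<comment> \<open>The predecessor of \<open>g\<close> on a shortest path from another vertex
      \<open>w\<close> is a neighbour of \<open>g\<close>.\<close>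
    then obtain w where "w \<in> pverts G" "g \<noteq> w" using ab by metis
    then show "\<exists>g'. (g, g') \<in> parcs G"
      using G.gdist_pred[of w g] G.arcs_symmetric g by blast
  qed
  note lex = gp_outer_lex_product[OF assms(3,7)]
  \<comment> \<open>With diameter 2, \<open>?S\<close> is the MMD relation of \<open>H\<close>
    itself.\<close>
  have "gp_outer H = max_clique (pverts H) ?S" if "diam H = 2"
    unfolding H.gp_outer_eq
    using H.MMD_iff_diam_le_2 H.gdist_le_diam that by (intro max_clique_cong) metis
  moreover have "gp_outer (graph_join K1 H) = max_clique (pverts H) ?S"
    using H.gp_outer_cone assms(6,7) by fastforce
  ultimately show ?thesis using lex by simp
qed

end
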